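(* Let $q$ be a prime power and $r\ge1$. If $\mathcal Q^-(2r+1,q)$ possesses an $m$-ovoid with $m>0$, then \[m\ge\frac{\sqrt{4q^{r+1}+4q+1}-3}{2(q-1)}.\]
   Context: $\mathcal Q^-(2r+1,q)$ is the elliptic quadric of rank $r$ in $\mathrm{PG}(2r+1,q)$ (points singular for a non-degenerate quadratic form of Witt index $r$ on $\mathbb F_q^{2r+2}$). An $m$-ovoid is a set of points of the quadric meeting every generator (maximal totally singular subspace, of projective dimension $r-1$) in exactly $m$ points. *)

theory Defs
  imports "HOL-Analysis.Cartesian_Space"
begin

definition polar :: "('a::field ^ 'n \<Rightarrow> 'a) \<Rightarrow> 'a ^ 'n \<Rightarrow> 'a ^ 'n \<Rightarrow> 'a" where
  "polar Q x y = Q (x + y) - Q x - Q y"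

definition quadratic_form :: "('a::field ^ 'n \<Rightarrow> 'a) \<Rightarrow> bool" where
  "quadratic_form Q \<longleftrightarrow>
     (\<forall>c x. Q (c *s x) = c\<^sup>2 * Q x) \<and>
     (\<forall>y. Vector_Spaces.linear (*s) (*) (\<lambda>x. polar Q x y)) \<and>
     (\<forall>x. Vector_Spaces.linear (*s) (*) (polar Q x))"

text \<open>The condition \<open>Q x = 0\<close> makes this the right notion in characteristic 2 as well: only
  singular vectors are excluded from the radical of the polar form.\<close>

definition nondegenerate :: "('a::field ^ 'n \<Rightarrow> 'a) \<Rightarrow> bool" where
  "nondegenerate Q \<longleftrightarrow> (\<forall>x. Q x = 0 \<and> (\<forall>y. polar Q x y = 0) \<longrightarrow> x = 0)"

definition totally_singular :: "('a::field ^ 'n \<Rightarrow> 'a) \<Rightarrow> ('a ^ 'n) set \<Rightarrow> bool" where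
  "totally_singular Q U \<longleftrightarrow> vec.subspace U \<and> (\<forall>x\<in>U. Q x = 0)"

text \<open>Vector space dimension, which exceeds projective dimension by one.\<close>

definition witt_index :: "('a::field ^ 'n \<Rightarrow> 'a) \<Rightarrow> nat" where
  "witt_index Q = Max {vec.dim U | U. totally_singular Q U}"

definition elliptic_form :: "nat \<Rightarrow> ('a::field ^ 'n \<Rightarrow> 'a) \<Rightarrow> bool" where
  "elliptic_form r Q \<longleftrightarrow>
     CARD('n) = 2 * r + 2 \<and> quadratic_form Q \<and> nondegenerate Q \<and> witt_index Q = r"

text \<open>Points of the projective space are the one-dimensional subspaces.\<close>

definition quadric :: "('a::field ^ 'n \<Rightarrow> 'a) \<Rightarrow> ('a ^ 'n) set set" where
  "quadric Q = {P. vec.dim P = 1 \<and> totally_singular Q P}"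

definition generator :: "('a::field ^ 'n \<Rightarrow> 'a) \<Rightarrow> ('a ^ 'n) set \<Rightarrow> bool" where
  "generator Q U \<longleftrightarrow> totally_singular Q U \<and> (\<forall>W. totally_singular Q W \<and> U \<subseteq> W \<longrightarrow> W = U)"

text \<open>Over a finite field all sets below are finite, so \<^const>\<open>card\<close> is the true cardinality.\<close>

definition m_ovoid :: "('a::{field,finite} ^ 'n \<Rightarrow> 'a) \<Rightarrow> nat \<Rightarrow> ('a ^ 'n) set set \<Rightarrow> bool" where
  "m_ovoid Q m X \<longleftrightarrow> X \<subseteq> quadric Q \<and> (\<forall>U. generator Q U \<longrightarrow> card {P \<in> X. P \<subseteq> U} = m)"

end

theory Submission
  imports Defs
begin

text \<open>Let \<open>D\<close> be the set of nonzero vectors on the points of an \<open>m\<close>-ovoid, \<open>k = (q - 1) m\<close> and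
  \<open>g w = |D \<inter> w\<^sup>\<bottom>|\<close>. Double counting along totally singular subspaces gives \<open>|D| = k (q\<^sup>r\<^sup>+\<^sup>1 + 1)\<close>
  and the value of \<open>g\<close> at singular vectors, and a variance argument then determines \<open>g\<close> at all
  nonzero vectors: with \<open>h = k (q\<^sup>r + 1)\<close> it is \<open>h - (q - 1) q\<^sup>r\<close> on \<open>D\<close> and \<open>h\<close> elsewhere. For \<open>x \<in> D\<close> the sum
  of \<open>(g w)\<^sup>2\<close> over \<open>w \<in> x\<^sup>\<bottom>\<close> counts triples \<open>(w, y, y')\<close> with \<open>y, y' \<in> D\<close> and \<open>w\<close> orthogonal to
  \<open>x, y, y'\<close>. Bounding it from below by the rank of \<open>x, y, y'\<close> yields
  \<open>(k + 1) (k + 2) \<ge> q\<^sup>r\<^sup>+\<^sup>1 + q\<close>, which is equivalent to the claim. In terms of the strongly regular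
  Cayley graph with connection set \<open>D\<close>, this says that \<open>0\<close> and \<open>x\<close> have at
  least \<open>q - 2\<close> common neighbours, the other multiples of \<open>x\<close>.\<close>

section \<open>Counting in finite vector spaces\<close>

lemma linear_functional:
  assumes "Vector_Spaces.linear (*s) (*) (f :: 'a::field ^ 'n \<Rightarrow> 'a)"
  shows "f (x + y) = f x + f y" "f (c *s x) = c * f x"
    "f (x - y) = f x - f y" "f 0 = 0"
proof -
  interpret f: Vector_Spaces.linear "(*s)" "(*)" f by fact
  show "f (x + y) = f x + f y" "f (c *s x) = c * f x"
    "f (x - y) = f x - f y" "f 0 = 0"
    by (fact f.add f.scale f.diff f.zero)+
qed

text \<open>Adjoining an independent vector \<open>b\<close> makes every element of the larger span
  uniquely \<open>c *s b + x\<close>, so each basis vector contributes a factor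
  \<open>CARD('a)\<close>.\<close>

lemma card_subspace:
  fixes S :: "('a::{field,finite} ^ 'n) set"
  assumes "vec.subspace S"
  shows "card S = CARD('a) ^ vec.dim S"
proof -
  have *: "card (vec.span B) = CARD('a) ^ card B"
    if "vec.independent B" for B :: "('a ^ 'n) set"
    using finite[of B] that
  proof (induction B rule: finite_induct)
    case (insert b B)
    then have nb: "b \<notin> vec.span B" and ind: "vec.independent B"
      by (simp_all add: vec.independent_insert)
    have "bij_betw (\<lambda>(c, x). c *s b + x) (UNIV \<times> vec.span B) (vec.span (insert b B))"
    proof (rule bij_betw_imageI)
      show "inj_on (\<lambda>(c, x). c *s b + x) (UNIV \<times> vec.span B)"
      proof (rule inj_onI, clarify)
        fix c x c' x'
        assume x: "x \<in> vec.span B" "x' \<in> vec.span B" and eq: "c *s b + x = c' *s b + x'"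
        then have "(c - c') *s b = x' - x"
          by (simp add: algebra_simps)
        then have "(c - c') *s b \<in> vec.span B"
          using x by (simp add: vec.span_diff)
        then have "c = c'"
          using nb vec.span_scale[of "(c - c') *s b" B "inverse (c - c')"]
          by (cases "c = c'") auto
        with eq show "c = c' \<and> x = x'" by simp
      qed
      show "(\<lambda>(c, x). c *s b + x) ` (UNIV \<times> vec.span B) = vec.span (insert b B)"
      proof (intro equalityI subsetI)
        fix y assume "y \<in> vec.span (insert b B)"
        then obtain c where "y - c *s b \<in> vec.span B"
          by (auto simp: vec.span_insert)
        then show "y \<in> (\<lambda>(c, x). c *s b + x) ` (UNIV \<times> vec.span B)"
          by (intro image_eqI[of _ _ "(c, y - c *s b)"]) auto
      next
        fix y assume "y \<in> (\<lambda>(c, x). c *s b + x) ` (UNIV \<times> vec.span B)"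
        then obtain c x where "y = c *s b + x" "x \<in> vec.span B" by auto
        then show "y \<in> vec.span (insert b B)"
          by (auto simp: vec.span_insert intro!: exI[of _ c])
      qed
    qed
    then have "card (vec.span (insert b B)) = CARD('a) * card (vec.span B)"
      by (auto dest: bij_betw_same_card simp: card_cartesian_product)
    with insert ind show ?case by simp
  qed simp
  obtain B where B: "B \<subseteq> S" "vec.independent B" "S \<subseteq> vec.span B" "card B = vec.dim S"
    by (rule vec.basis_exists)
  then have "S = vec.span B"
    using assms by (metis subset_antisym vec.span_minimal)
  then show ?thesis
    using *[OF B(2)] B(4) by simp
qed

lemma card_field_ge_2: "CARD('a::{field,finite}) \<ge> 2"
proof -
  have "card {0, 1 :: 'a} \<le> CARD('a)" by (rule card_mono) auto
  then show ?thesis by simp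
qed

lemma card_kernel:
  fixes E :: "('a::{field,finite} ^ 'n) set"
  assumes E: "vec.subspace E" and f: "Vector_Spaces.linear (*s) (*) f"
    and e: "e \<in> E" "f e \<noteq> 0"
  shows "CARD('a) * card {w \<in> E. f w = 0} = card E"
proof -
  note lin = linear_functional[OF f]
  \<comment> \<open>Each \<open>y\<close> in \<open>E\<close> is uniquely a multiple of
    \<open>e\<close> plus a kernel element; applying \<open>f\<close> forces the multiplier
    \<open>f y / f e\<close>.\<close>
  have "bij_betw (\<lambda>(c, x). c *s e + x) (UNIV \<times> {w \<in> E. f w = 0}) E"
  proof (rule bij_betw_imageI)
    show "inj_on (\<lambda>(c, x). c *s e + x) (UNIV \<times> {w \<in> E. f w = 0})"
    proof (rule inj_onI, clarify)
      fix c x c' x'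
      assume x: "f x = 0" "f x' = 0" and eq: "c *s e + x = c' *s e + x'"
      have "f (c *s e + x) = f (c' *s e + x')" using eq by (rule arg_cong)
      then have "c * f e = c' * f e" by (simp add: lin x)
      with eq e show "c = c' \<and> x = x'" by simp
    qed
    show "(\<lambda>(c, x). c *s e + x) ` (UNIV \<times> {w \<in> E. f w = 0}) = E"
    proof (intro equalityI subsetI)
      fix y assume "y \<in> E"
      then show "y \<in> (\<lambda>(c, x). c *s e + x) ` (UNIV \<times> {w \<in> E. f w = 0})"
        using e E by (intro image_eqI[of _ _ "(f y / f e, y - (f y / f e) *s e)"])
          (auto simp: lin vec.subspace_diff vec.subspace_scale)
    qed (use E e in \<open>auto intro: vec.subspace_add vec.subspace_scale\<close>)
  qed
  then show ?thesis
    by (auto dest!: bij_betw_same_card simp: card_cartesian_product)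
qed

lemma card_span_le:
  "card (vec.span B) \<le> CARD('a) ^ card B" for B :: "('a::{field,finite} ^ 'n) set"
  using vec.dim_le_card'[of B] card_field_ge_2[where 'a='a]
  by (simp add: card_subspace power_increasing)

section \<open>Quadratic forms\<close>

locale quadratic_space =
  fixes Q :: "'a::{field,finite} ^ 'n \<Rightarrow> 'a"
  assumes quadratic: "quadratic_form Q"
begin

lemma Q_scale: "Q (c *s x) = c\<^sup>2 * Q x"
  using quadratic by (auto simp: quadratic_form_def)

lemma Q_zero [simp]: "Q 0 = 0"
  using Q_scale[of 0 0] by simp

lemma linear_polar1: "Vector_Spaces.linear (*s) (*) (\<lambda>x. polar Q x y)"
  and linear_polar2: "Vector_Spaces.linear (*s) (*) (polar Q x)"
  using quadratic by (auto simp: quadratic_form_def)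

lemmas polar_simps [simp] = linear_functional[OF linear_polar1] linear_functional[OF linear_polar2]

lemma polar_sym: "polar Q x y = polar Q y x"
  by (simp add: polar_def add.commute)

lemma Q_add: "Q (x + y) = Q x + Q y + polar Q x y"
  by (simp add: polar_def)

lemma polar_self: "polar Q x x = 2 * Q x"
proof -
  have "x + x = 2 *s x" by (simp add: vec_eq_iff)
  then show ?thesis by (simp add: polar_def Q_scale)
qed

section \<open>Orthogonal complements and duality\<close>

definition perp :: "('a ^ 'n) set \<Rightarrow> ('a ^ 'n) set" where
  "perp U = {w. \<forall>u\<in>U. polar Q w u = 0}"

lemma perp_span: "perp (vec.span B) = perp B"
proof
  show "perp B \<subseteq> perp (vec.span B)"
  proof
    fix w assume w: "w \<in> perp B"
    have "polar Q w u = 0" if "u \<in> vec.span B" for u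
      using that by (induction rule: vec.span_induct_alt) (use w in \<open>auto simp: perp_def\<close>)
    then show "w \<in> perp (vec.span B)" by (simp add: perp_def)
  qed
qed (auto simp: perp_def vec.span_base)

lemma perp_insert: "perp (insert z U) = {w \<in> perp U. polar Q w z = 0}"
  by (auto simp: perp_def)

lemma subspace_perp: "vec.subspace (perp U)"
  by (auto simp: vec.subspace_def perp_def)

text \<open>Count orthogonal pairs in \<open>E\<close> times \<open>U\<close> from both sides. A
  vector of \<open>perp U\<close> is orthogonal to all of \<open>U\<close>, any other vector to
  exactly a fraction \<open>1 / CARD('a)\<close> of it. Degenerate polar forms are covered, so the
  identity is available before the radical is known.\<close>

lemma card_perp_duality:
  assumes E: "vec.subspace E" and U: "vec.subspace U"
  shows "card (E \<inter> perp U) * card U = card (U \<inter> perp E) * card E"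
proof -
  let ?q = "CARD('a)"
  have half: "?q * (\<Sum>e\<in>E. card {u \<in> U. polar Q e u = 0})
      = card E * card U + (?q - 1) * (card (E \<inter> perp U) * card U)"
    if U: "vec.subspace U" for E U
  proof -
    have "?q * card {u \<in> U. polar Q e u = 0} = card U + (if e \<in> perp U then (?q - 1) * card U else 0)"
      for e
    proof (cases "e \<in> perp U")
      case True
      then have "{u \<in> U. polar Q e u = 0} = U" by (auto simp: perp_def)
      with True show ?thesis
        using card_field_ge_2[where 'a='a] by (simp add: algebra_simps diff_mult_distrib2)
    next
      case False
      then obtain u where "u \<in> U" "polar Q e u \<noteq> 0" by (auto simp: perp_def)
      with False card_kernel[OF U linear_polar2] show ?thesis by auto
    qed
    then have "?q * (\<Sum>e\<in>E. card {u \<in> U. polar Q e u = 0})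
       = (\<Sum>e\<in>E. card U + (if e \<in> perp U then (?q - 1) * card U else 0))"
      by (simp add: sum_distrib_left)
    also have "\<dots> = card E * card U + (?q - 1) * (card (E \<inter> perp U) * card U)"
      by (simp add: sum.distrib flip: sum.inter_restrict)
    finally show ?thesis .
  qed
  have "(\<Sum>e\<in>E. card {u \<in> U. polar Q e u = 0}) = (\<Sum>u\<in>U. card {e \<in> E. polar Q e u = 0})"
    unfolding card_eq_sum by (rule sum.swap_restrict) auto
  also have "\<dots> = (\<Sum>u\<in>U. card {e \<in> E. polar Q u e = 0})"
    by (simp add: polar_sym)
  finally have swap: "(\<Sum>e\<in>E. card {u \<in> U. polar Q e u = 0}) = (\<Sum>u\<in>U. card {e \<in> E. polar Q u e = 0})" .
  have "card E * card U + (?q - 1) * (card (E \<inter> perp U) * card U)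
     = card U * card E + (?q - 1) * (card (U \<inter> perp E) * card E)"
    unfolding half[OF U, of E, symmetric] half[OF E, of U, symmetric] swap ..
  then show ?thesis
    using card_field_ge_2[where 'a='a] by simp
qed

section \<open>Totally singular subspaces\<close>

lemma totally_singularD:
  assumes "totally_singular Q U"
  shows "vec.subspace U" "x \<in> U \<Longrightarrow> Q x = 0" "x \<in> U \<Longrightarrow> y \<in> U \<Longrightarrow> polar Q x y = 0"
  using assms by (auto simp: totally_singular_def polar_def vec.subspace_add)

lemma totally_singular_zero: "totally_singular Q {0}"
  by (simp add: totally_singular_def)

lemma totally_singular_subset_perp: "totally_singular Q U \<Longrightarrow> U \<subseteq> perp U"
  by (auto simp: perp_def totally_singularD)

lemma totally_singular_insert:
  assumes U: "totally_singular Q U" and z: "z \<in> perp U" "Q z = 0"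
  shows "totally_singular Q (vec.span (insert z U))"
  unfolding totally_singular_def
proof (intro conjI ballI)
  show "vec.subspace (vec.span (insert z U))" by (rule vec.subspace_span)
  fix y assume "y \<in> vec.span (insert z U)"
  then obtain c where c: "y - c *s z \<in> U"
    using totally_singularD(1)[OF U] by (auto simp: vec.span_insert vec.span_eq_iff[THEN iffD2])
  have "Q (c *s z + (y - c *s z)) = 0"
    using z totally_singularD(2)[OF U c] c by (simp only: Q_add Q_scale) (auto simp: perp_def)
  then show "Q y = 0" by simp
qed

lemma dim_span_insert:
  assumes "vec.subspace U" "z \<notin> U"
  shows "vec.dim (vec.span (insert z U)) = Suc (vec.dim U)"
  using assms by (simp add: vec.dim_insert vec.span_eq_iff[THEN iffD2])

text \<open>The witness is \<open>(W \<inter> perp U) + U\<close>, a sum of two orthogonal totally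
  singular spaces. Duality makes up for the dimension lost in cutting \<open>W\<close> down, because
  \<open>W \<inter> perp U \<inter> U\<close> lies in \<open>U \<inter> perp W\<close>. With
  \<open>W\<close> of maximal dimension this replaces Witt's extension theorem.\<close>

lemma totally_singular_extend:
  assumes U: "totally_singular Q U" and W: "totally_singular Q W"
  shows "\<exists>Y. totally_singular Q Y \<and> U \<subseteq> Y \<and> vec.dim Y \<ge> vec.dim W"
proof -
  let ?K = "W \<inter> perp U"
  let ?Y = "{x + y |x y. x \<in> ?K \<and> y \<in> U}"
  note sU = totally_singularD(1)[OF U] and sW = totally_singularD(1)[OF W]
  have sK: "vec.subspace ?K" by (intro vec.subspace_inter sW subspace_perp)
  have sI: "vec.subspace (U \<inter> perp W)" by (intro vec.subspace_inter sU subspace_perp)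
  have sY: "vec.subspace ?Y" using vec.subspace_sums[OF sK sU] .
  have "Q (x + y) = 0" if "x \<in> ?K" "y \<in> U" for x y
    using that totally_singularD(2)[OF U] totally_singularD(2)[OF W]
    by (auto simp: Q_add perp_def)
  with sY have Y: "totally_singular Q ?Y" by (auto simp: totally_singular_def)
  have UY: "U \<subseteq> ?Y"
  proof
    fix u assume "u \<in> U"
    then show "u \<in> ?Y"
      using vec.subspace_0[OF sK] by (intro CollectI exI[of _ 0] exI[of _ u]) simp
  qed
  have "CARD('a) ^ (vec.dim ?K + vec.dim U) = CARD('a) ^ (vec.dim (U \<inter> perp W) + vec.dim W)"
    using card_perp_duality[OF sW sU] by (simp add: card_subspace sK sU sW sI power_add)
  then have "vec.dim ?K + vec.dim U = vec.dim (U \<inter> perp W) + vec.dim W"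
    using card_field_ge_2[where 'a='a] by (subst (asm) power_inject_exp) auto
  moreover have "vec.dim ?Y + vec.dim (?K \<inter> U) = vec.dim ?K + vec.dim U"
    by (rule vec.dim_sums_Int[OF sK sU])
  moreover have "vec.dim (?K \<inter> U) \<le> vec.dim (U \<inter> perp W)"
    using totally_singular_subset_perp[OF W] by (intro vec.dim_subset) auto
  ultimately have "vec.dim ?Y \<ge> vec.dim W" by linarith
  with Y UY show ?thesis by blast
qed

definition singular_perp :: "('a ^ 'n) set \<Rightarrow> ('a ^ 'n) set" where
  "singular_perp U = {z \<in> perp U. Q z = 0}"

lemma perp_span_insert: "perp (vec.span (insert z U)) = {w \<in> perp U. polar Q w z = 0}"
  by (simp only: perp_span perp_insert)

lemma totally_singular_subset_singular_perp:
  "totally_singular Q U \<Longrightarrow> U \<subseteq> singular_perp U"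
  using totally_singular_subset_perp totally_singularD(2) by (auto simp: singular_perp_def)

text \<open>If \<open>y\<close> is not orthogonal to the singular vector \<open>z\<close>, then \<open>Q\<close> is a non-constant
  affine function on the line \<open>y + c z\<close>, so it vanishes exactly once there.\<close>

lemma card_singular_not_perp:
  assumes U: "totally_singular Q U" and z: "z \<in> singular_perp U"
  shows "CARD('a) * card {y \<in> singular_perp U. polar Q y z \<noteq> 0} = card {y \<in> perp U. polar Q y z \<noteq> 0}"
    (is "_ * card ?A = card ?B")
proof -
  have zU: "z \<in> perp U" and Qz: "Q z = 0" using z by (auto simp: singular_perp_def)
  have zz: "polar Q z z = 0" by (simp add: polar_self Qz)
  have "bij_betw (\<lambda>(c, y). y + c *s z) (UNIV \<times> ?A) ?B"
  proof (rule bij_betw_imageI)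
    show "inj_on (\<lambda>(c, y). y + c *s z) (UNIV \<times> ?A)"
    proof (rule inj_onI, clarify)
      fix c y c' y'
      assume y: "y \<in> singular_perp U" "y' \<in> singular_perp U" "polar Q y z \<noteq> 0"
        and eq: "y + c *s z = y' + c' *s z"
      then have y': "y' = y + (c - c') *s z" by (simp add: algebra_simps)
      have "Q y' = Q y + (c - c') * polar Q y z"
        unfolding y' by (simp add: Q_add Q_scale Qz)
      with y have "c = c'" by (simp add: singular_perp_def)
      with eq show "c = c' \<and> y = y'" by simp
    qed
    show "(\<lambda>(c, y). y + c *s z) ` (UNIV \<times> ?A) = ?B"
    proof (intro equalityI subsetI)
      fix w assume w: "w \<in> ?B"
      define c where "c = Q w / polar Q w z"
      have "Q (w + (- c) *s z) = Q w + (- c) * polar Q w z"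
        by (simp only: Q_add Q_scale polar_simps Qz) simp
      also have "\<dots> = 0" using w by (simp add: c_def)
      finally have "w + (- c) *s z \<in> ?A"
        using w zU zz unfolding singular_perp_def by (simp add: perp_def)
      then show "w \<in> (\<lambda>(c, y). y + c *s z) ` (UNIV \<times> ?A)"
        by (intro image_eqI[of _ _ "(c, w + (- c) *s z)"]) auto
    qed (use zU zz in \<open>auto simp: singular_perp_def perp_def\<close>)
  qed
  then show ?thesis
    by (auto dest!: bij_betw_same_card simp: card_cartesian_product)
qed

end

section \<open>Elliptic quadrics\<close>

locale elliptic_space = quadratic_space Q for Q :: "'a::{field,finite} ^ 'n \<Rightarrow> 'a" +
  fixes q r :: nat
  assumes CARD_field: "CARD('a) = q" and elliptic: "elliptic_form r Q"
begin

lemma q_ge_2: "q \<ge> 2"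
  using card_field_ge_2 CARD_field by metis

lemma card_subspace_q: "vec.subspace S \<Longrightarrow> card S = q ^ vec.dim S" for S :: "('a ^ 'n) set"
  by (simp add: card_subspace CARD_field)

lemma CARD_n: "CARD('n) = 2 * r + 2"
  using elliptic by (simp add: elliptic_form_def)

lemma card_space: "CARD('a ^ 'n) = q ^ (2 * r + 2)"
  using card_subspace_q[OF vec.subspace_UNIV] unfolding vec_dim_card CARD_n .

lemma witt_index_eq: "Max {vec.dim U | U. totally_singular Q U} = r"
  using elliptic by (simp add: elliptic_form_def witt_index_def)

lemma finite_dims: "finite {vec.dim U | U. totally_singular Q U}"
  by simp

lemma dim_totally_singular_le: "totally_singular Q U \<Longrightarrow> vec.dim U \<le> r"
  using Max_ge[OF finite_dims] witt_index_eq by auto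

lemma ex_totally_singular: obtains W where "totally_singular Q W" "vec.dim W = r"
proof -
  have "r \<in> {vec.dim U | U. totally_singular Q U}"
    using Max_in[OF finite_dims] totally_singular_zero unfolding witt_index_eq by blast
  then show ?thesis using that by auto
qed

lemma totally_singular_max:
  assumes "totally_singular Q U" "totally_singular Q W" "U \<subseteq> W" "vec.dim U = r"
  shows "W = U"
  using assms dim_totally_singular_le[of W]
  by (metis totally_singularD(1) vec.subspace_dim_equal)

text \<open>Maximality under inclusion and maximal dimension agree: the extension of a generator to
  dimension at least \<open>r\<close> must be the generator itself.\<close>

lemma generator_iff: "generator Q U \<longleftrightarrow> totally_singular Q U \<and> vec.dim U = r"
proof
  assume g: "generator Q U"
  obtain W where "totally_singular Q W" "vec.dim W = r" by (rule ex_totally_singular)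
  with g show "totally_singular Q U \<and> vec.dim U = r"
    using totally_singular_extend[of U W] dim_totally_singular_le[of U]
    by (auto simp: generator_def)
next
  assume "totally_singular Q U \<and> vec.dim U = r"
  then show "generator Q U"
    using totally_singular_max by (auto simp: generator_def)
qed

lemma singular_perp_generator:
  assumes "totally_singular Q U" "vec.dim U = r" "z \<in> perp U" "Q z = 0"
  shows "z \<in> U"
proof -
  have "vec.span (insert z U) = U"
    using assms by (intro totally_singular_max totally_singular_insert) (auto intro: vec.span_base)
  then show ?thesis by (metis insertI1 vec.span_base)
qed

lemma extend_totally_singular:
  assumes U: "totally_singular Q U" "vec.dim U < r"
  obtains z where "z \<in> perp U" "Q z = 0" "z \<notin> U"
proof -
  obtain W where "totally_singular Q W" "vec.dim W = r" by (rule ex_totally_singular)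
  then obtain Y where Y: "totally_singular Q Y" "U \<subseteq> Y" "vec.dim Y \<ge> r"
    using totally_singular_extend[OF U(1)] by metis
  then obtain z where z: "z \<in> Y" "z \<notin> U" using U by (metis leD subsetI subset_antisym)
  then show ?thesis
    using Y by (intro that[of z]) (auto simp: perp_def totally_singularD[OF Y(1)])
qed

text \<open>The radical condition is a hypothesis because the next lemma, which proves the radical
  trivial, already needs this count for a totally singular space of dimension
  \<open>r\<close>.\<close>

lemma card_perp_anisotropic_radical:
  assumes U: "vec.subspace U" and "U \<inter> perp UNIV = {0}"
  shows "card (perp U) * card U = q ^ (2 * r + 2)"
  using card_perp_duality[OF vec.subspace_UNIV U] unfolding card_space assms(2) by simp

text \<open>\<open>nondegenerate\<close> excludes only singular radical vectors. A nonsingular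
  radical vector \<open>e\<close> would force characteristic 2, where squaring is bijective, so
  every vector orthogonal to a generator \<open>W\<close> becomes singular after adding a multiple
  of \<open>e\<close>. Then \<open>perp W\<close>, of dimension \<open>r + 2\<close>, would lie in
  the span of \<open>e\<close> and \<open>W\<close>, of dimension at most
  \<open>r + 1\<close>.\<close>

lemma nondegenerate_polar: "perp UNIV = {0}"
proof (rule ccontr)
  assume "perp UNIV \<noteq> {0}"
  then obtain e where e: "e \<noteq> 0" "\<And>y. polar Q e y = 0"
    using vec.subspace_0[OF subspace_perp] by (auto simp: perp_def)
  have nd: "x = 0" if "Q x = 0" "x \<in> perp UNIV" for x
    using elliptic that by (auto simp: elliptic_form_def nondegenerate_def perp_def)
  have Qe: "Q e \<noteq> 0" using nd e by (auto simp: perp_def)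
  with polar_self[of e] e have two: "(2::'a) = 0" by simp
  have "inj (\<lambda>c::'a. c\<^sup>2)"
  proof (rule injI)
    fix c d :: 'a assume "c\<^sup>2 = d\<^sup>2"
    then have "(c - d)\<^sup>2 = 2 * (d * (d - c))" by (simp add: power2_eq_square algebra_simps)
    then show "c = d" by (simp add: two)
  qed
  then have sq: "surj (\<lambda>c::'a. c\<^sup>2)" by (rule finite_UNIV_inj_surj[OF finite])
  obtain W where W: "totally_singular Q W" "vec.dim W = r" by (rule ex_totally_singular)
  note sW = totally_singularD(1)[OF W(1)]
  have "W \<inter> perp UNIV = {0}"
    using nd totally_singularD(2)[OF W(1)] vec.subspace_0[OF sW] vec.subspace_0[OF subspace_perp]
    by blast
  then have "q ^ (vec.dim (perp W) + r) = q ^ (2 * r + 2)"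
    using card_perp_anisotropic_radical[OF sW]
    by (simp add: card_subspace_q sW W(2) subspace_perp power_add)
  then have dW: "vec.dim (perp W) = r + 2" using q_ge_2 by (subst (asm) power_inject_exp) auto
  have "vec.dim (vec.span (insert e W)) \<le> r + 1"
    using W(2) vec.dim_insert[of e W] by simp
  moreover have "vec.dim (perp W) \<le> vec.dim (vec.span (insert e W))"
    if "perp W \<subseteq> vec.span (insert e W)" using that by (rule vec.dim_subset)
  ultimately obtain v where v: "v \<in> perp W" "v \<notin> vec.span (insert e W)" using dW by fastforce
  obtain c where c: "c\<^sup>2 = - (Q v / Q e)" using surjD[OF sq, of "- (Q v / Q e)"] by auto
  have "Q (v + c *s e) = 0"
    using Qe by (simp add: Q_add Q_scale polar_sym[of v e] e c)
  moreover have "v + c *s e \<in> perp W"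
    using v e by (auto simp: perp_def)
  ultimately have "v + c *s e \<in> W" using W by (metis singular_perp_generator)
  then have "v + c *s e \<in> vec.span (insert e W)" by (simp add: vec.span_base)
  then have "v + c *s e - c *s e \<in> vec.span (insert e W)"
    by (intro vec.span_diff vec.span_scale) (auto intro: vec.span_base)
  with v show False by simp
qed

lemma card_perp:
  assumes "vec.subspace U"
  shows "card (perp U) * card U = q ^ (2 * r + 2)"
  using card_perp_anisotropic_radical[OF assms] vec.subspace_0[OF assms]
  by (auto simp: nondegenerate_polar)

lemma card_perp_span: "card (perp B) * card (vec.span B) = q ^ (2 * r + 2)"
  using card_perp[of "vec.span B"] by (simp add: perp_span)

lemma card_perp_totally_singular:
  assumes "totally_singular Q U" "vec.dim U + i = r"
  shows "card (perp U) = q ^ (r + i + 2)"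
proof -
  have "card (perp U) * q ^ vec.dim U = q ^ (2 * r + 2)"
    using card_perp[OF totally_singularD(1)[OF assms(1)]]
    by (simp only: card_subspace_q[OF totally_singularD(1)[OF assms(1)]])
  also have "2 * r + 2 = (r + i + 2) + vec.dim U" using assms(2) by simp
  finally show ?thesis using q_ge_2 by (simp add: power_add)
qed

text \<open>Induction on the codimension \<open>i\<close> of \<open>U\<close> in a generator. For a
  new singular \<open>z\<close>, the singular vectors of \<open>perp U\<close> orthogonal to
  \<open>z\<close> are handled by the induction hypothesis, and those not orthogonal to
  \<open>z\<close> are a fraction \<open>1 / q\<close> of all such vectors of \<open>perp U\<close>.
  The term on the left avoids subtraction of naturals.\<close>

lemma card_singular_perp:
  assumes "totally_singular Q U" "vec.dim U + i = r"
  shows "card (singular_perp U) + q ^ (r + 1) = q ^ r + q ^ (r + i + 1)"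
  using assms
proof (induction i arbitrary: U)
  case 0
  then have "singular_perp U = U"
    using totally_singular_subset_singular_perp singular_perp_generator
    by (auto simp: singular_perp_def)
  with 0 show ?case
    by (simp add: card_subspace_q totally_singularD)
next
  case (Suc i)
  note sU = totally_singularD(1)[OF Suc.prems(1)]
  obtain z where z: "z \<in> perp U" "Q z = 0" "z \<notin> U"
    using Suc.prems by (auto intro: extend_totally_singular[OF Suc.prems(1)])
  define U' where "U' = vec.span (insert z U)"
  have U': "totally_singular Q U'" "vec.dim U' + i = r"
    using totally_singular_insert[OF Suc.prems(1) z(1,2)] dim_span_insert[OF sU z(3)] Suc.prems
    by (simp_all add: U'_def)
  let ?A = "{y \<in> singular_perp U. polar Q y z \<noteq> 0}"
  have perp_U': "perp U' = {w \<in> perp U. polar Q w z = 0}"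
    unfolding U'_def by (rule perp_span_insert)
  have "singular_perp U = singular_perp U' \<union> ?A" "singular_perp U' \<inter> ?A = {}"
    by (auto simp: singular_perp_def perp_U')
  then have 1: "card (singular_perp U) = card (singular_perp U') + card ?A"
    by (metis card_Un_disjoint finite)
  have "perp U = perp U' \<union> {y \<in> perp U. polar Q y z \<noteq> 0}" "perp U' \<inter> {y \<in> perp U. polar Q y z \<noteq> 0} = {}"
    by (auto simp: perp_U')
  then have "card (perp U) = card (perp U') + card {y \<in> perp U. polar Q y z \<noteq> 0}"
    by (metis card_Un_disjoint finite)
  also have "card {y \<in> perp U. polar Q y z \<noteq> 0} = q * card ?A"
    using card_singular_not_perp[OF Suc.prems(1), of z] z
    by (simp add: CARD_field singular_perp_def)
  finally have "q * q ^ (r + i + 2) = q * (q ^ (r + i + 1) + card ?A)"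
    using card_perp_totally_singular[OF U'] card_perp_totally_singular[OF Suc.prems]
    by (simp add: algebra_simps)
  then have "q ^ (r + i + 2) = q ^ (r + i + 1) + card ?A"
    using q_ge_2 by simp
  with 1 Suc.IH[OF U'] show ?case by simp
qed

end

section \<open>Sets meeting all generators equally\<close>

text \<open>\<open>D\<close> is the set of nonzero vectors on the points of an \<open>m\<close>-ovoid and \<open>k = (q - 1) m\<close>.\<close>

locale vector_ovoid = elliptic_space Q q r
  for Q :: "'a::{field,finite} ^ 'n \<Rightarrow> 'a" and q r +
  fixes D :: "('a ^ 'n) set" and k :: nat
  assumes D_singular: "y \<in> D \<Longrightarrow> Q y = 0" and D_nonzero: "0 \<notin> D"
    and D_scale: "y \<in> D \<Longrightarrow> c \<noteq> 0 \<Longrightarrow> c *s y \<in> D"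
    and card_D_generator: "generator Q U \<Longrightarrow> card (D \<inter> U) = k"
begin

lemma sum_card_split:
  assumes "\<And>y. y \<in> D \<inter> U \<Longrightarrow> f y = \<alpha>" "\<And>y. y \<in> D \<inter> perp U - U \<Longrightarrow> f y = \<beta>"
    and "U \<subseteq> perp U"
  shows "(\<Sum>y\<in>D \<inter> perp U. f y)
    = card (D \<inter> U) * \<alpha> + (card (D \<inter> perp U) - card (D \<inter> U)) * (\<beta> :: nat)"
proof -
  have sub: "D \<inter> U \<subseteq> D \<inter> perp U" using assms(3) by auto
  have "(\<Sum>y\<in>D \<inter> perp U. f y) = (\<Sum>y\<in>D \<inter> perp U - D \<inter> U. f y) + (\<Sum>y\<in>D \<inter> U. f y)"
    by (rule sum.subset_diff[OF sub]) simp
  also have "(\<Sum>y\<in>D \<inter> perp U - D \<inter> U. f y) = (\<Sum>y\<in>D \<inter> perp U - D \<inter> U. \<beta>)"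
    by (rule sum.cong) (auto intro: assms(2))
  also have "(\<Sum>y\<in>D \<inter> U. f y) = (\<Sum>y\<in>D \<inter> U. \<alpha>)"
    by (rule sum.cong) (auto intro: assms(1))
  finally show ?thesis by (simp add: card_Diff_subset[OF _ sub])
qed

text \<open>Descending induction on \<open>vec.dim U\<close>: the identities for the totally singular spaces
  \<open>\<langle>z, U\<rangle>\<close> are summed over all singular \<open>z\<close> in \<open>perp U - U\<close>.\<close>

lemma card_D_perp:
  assumes "totally_singular Q U" "vec.dim U + i = r"
  shows "card (D \<inter> perp U) + q ^ (i + 1) * card (D \<inter> U) = k * (q ^ (i + 1) + 1)"
  using assms
proof (induction i arbitrary: U)
  case 0
  then have "D \<inter> perp U = D \<inter> U"
    using totally_singular_subset_perp singular_perp_generator D_singular by auto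
  moreover have "card (D \<inter> U) = k"
    using 0 by (intro card_D_generator) (simp add: generator_iff)
  ultimately show ?case by simp
next
  case (Suc i)
  note tsU = Suc.prems(1)
  note sU = totally_singularD(1)[OF tsU]
  note U_perp = totally_singular_subset_perp[OF tsU]
  define L where "L z = vec.span (insert z U)" for z
  define Z where "Z = singular_perp U - U"
  define a where "a = card (D \<inter> U)"
  define b where "b = card (D \<inter> perp U)"
  define u where "u = q ^ vec.dim U"
  define t where "t = q ^ i"
  have card_U: "card U = u" by (simp add: u_def card_subspace_q sU)
  have qr: "q ^ r = u * t * q"
    unfolding Suc.prems(2)[symmetric] by (simp add: power_add u_def t_def)
  have ab: "a \<le> b" unfolding a_def b_def using U_perp by (intro card_mono) auto
  have L: "totally_singular Q (L z)" "vec.dim (L z) + i = r" "U \<subseteq> L z" "z \<in> L z"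
    "perp (L z) = {w \<in> perp U. polar Q w z = 0}"
    if "z \<in> perp U" "Q z = 0" "z \<notin> U" for z
    using that Suc.prems(2) dim_span_insert[OF sU that(3)] totally_singular_insert[OF tsU that(1,2)]
      perp_span_insert[of z U]
    by (auto simp: L_def intro: vec.span_base)
  have Z: "z \<in> perp U" "Q z = 0" "z \<notin> U" if "z \<in> Z" for z
    using that by (auto simp: Z_def singular_perp_def)
  have Du: "y \<in> perp U" "Q y = 0" "y \<notin> U" if "y \<in> D \<inter> perp U - U" for y
    using that D_singular by auto
  have "card (singular_perp U) = card Z + u"
    using card_Diff_subset[of U "singular_perp U"] card_mono[of "singular_perp U" U]
      totally_singular_subset_singular_perp[OF tsU] by (simp add: Z_def card_U)
  then have card_Z: "card Z + u + u * t * q * q = u * t * q + u * t * q * t * q * q"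
    using card_singular_perp[OF Suc.prems] by (simp add: power_add qr t_def ac_simps)
  have card_L: "card (L z) = q * u" if "z \<in> perp U" "Q z = 0" "z \<notin> U" for z
    using dim_span_insert[OF sU that(3)] by (simp add: L_def card_subspace_q u_def)
  \<comment> \<open>The number of singular vectors outside \<open>U\<close> in
    \<open>perp (L y)\<close>, read off from \<open>card_singular_perp\<close>. That the
    subtractions do not truncate is checked before passing to the reals.\<close>
  define v where "v = u * t * q + u * t * q * t * q - u * t * q * q - u"
  have card_perp_Z: "card {z \<in> Z. polar Q y z = 0} = v" if y: "y \<in> D \<inter> perp U - U" for y
  proof -
    note Ly = L[OF Du[OF y]]
    have "{z \<in> Z. polar Q y z = 0} = singular_perp (L y) - U"
      by (auto simp: Z_def singular_perp_def Ly polar_sym)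
    moreover have "U \<subseteq> singular_perp (L y)"
      using totally_singular_subset_singular_perp[OF Ly(1)] Ly(3) by auto
    moreover have "card (singular_perp (L y)) + u * t * q * q = u * t * q + u * t * q * t * q"
      using card_singular_perp[OF Ly(1,2)] by (simp add: power_add qr t_def ac_simps)
    ultimately show ?thesis
      by (simp add: card_Diff_subset card_U v_def)
  qed
  have card_L_Z: "card {z \<in> Z. y \<in> L z} = (q - 1) * u" if y: "y \<in> D \<inter> perp U - U" for y
  proof -
    note Ly = L[OF Du[OF y]]
    \<comment> \<open>Exchange property: for \<open>y\<close>, \<open>z\<close> outside
      \<open>U\<close>, \<open>y\<close> lies in \<open>L z\<close> exactly when \<open>z\<close>
      lies in \<open>L y\<close>.\<close>
    have "{z \<in> Z. y \<in> L z} = L y - U"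
    proof (intro equalityI subsetI)
      fix z assume "z \<in> {z \<in> Z. y \<in> L z}"
      then show "z \<in> L y - U"
        using y vec.in_span_insert[of y z U] by (auto simp: L_def vec.span_eq_iff[THEN iffD2, OF sU] Z_def)
    next
      fix z assume z: "z \<in> L y - U"
      then have "z \<in> Z"
        using Ly totally_singularD(2)[OF Ly(1)] totally_singular_subset_perp[OF Ly(1)]
        by (auto simp: Z_def singular_perp_def)
      with z show "z \<in> {z \<in> Z. y \<in> L z}"
        using vec.in_span_insert[of z y U] by (auto simp: L_def vec.span_eq_iff[THEN iffD2, OF sU])
    qed
    then show ?thesis
      using Ly(3) by (simp add: card_Diff_subset card_L[OF Du[OF y]] card_U diff_mult_distrib)
  qed
  \<comment> \<open>Both terms of the induction hypothesis are summed over \<open>Z\<close> by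
    double counting. A vector of \<open>D \<inter> U\<close> is met by every \<open>z\<close>, and a
    vector of \<open>D \<inter> perp U - U\<close> by a constant number of them.\<close>
  have "(\<Sum>z\<in>Z. card (D \<inter> perp (L z))) = (\<Sum>z\<in>Z. card {y \<in> D \<inter> perp U. polar Q y z = 0})"
    by (intro sum.cong arg_cong[where f=card]) (auto simp: L Z)
  also have "\<dots> = (\<Sum>y\<in>D \<inter> perp U. card {z \<in> Z. polar Q y z = 0})"
    unfolding card_eq_sum by (rule sum.swap_restrict) auto
  also have "\<dots> = a * card Z + (b - a) * v"
    unfolding a_def b_def
  proof (rule sum_card_split[OF _ card_perp_Z U_perp])
    fix y assume "y \<in> D \<inter> U"
    then have "{z \<in> Z. polar Q y z = 0} = Z"
      using Z by (auto simp: perp_def polar_sym)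
    then show "card {z \<in> Z. polar Q y z = 0} = card Z" by simp
  qed
  finally have sum1: "(\<Sum>z\<in>Z. card (D \<inter> perp (L z))) = a * card Z + (b - a) * v" .
  have "(\<Sum>z\<in>Z. card (D \<inter> L z)) = (\<Sum>z\<in>Z. card {y \<in> D \<inter> perp U. y \<in> L z})"
  proof (intro sum.cong arg_cong[where f=card] refl)
    fix z assume "z \<in> Z"
    then have "L z \<subseteq> perp U"
      using totally_singular_subset_perp[of "L z"] by (auto simp: L Z)
    then show "D \<inter> L z = {y \<in> D \<inter> perp U. y \<in> L z}" by auto
  qed
  also have "\<dots> = (\<Sum>y\<in>D \<inter> perp U. card {z \<in> Z. y \<in> L z})"
    unfolding card_eq_sum by (rule sum.swap_restrict) auto
  also have "\<dots> = a * card Z + (b - a) * ((q - 1) * u)"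
    unfolding a_def b_def
  proof (rule sum_card_split[OF _ card_L_Z U_perp])
    fix y assume "y \<in> D \<inter> U"
    then have "{z \<in> Z. y \<in> L z} = Z"
      using L(3) Z by auto
    then show "card {z \<in> Z. y \<in> L z} = card Z" by simp
  qed
  finally have sum2: "(\<Sum>z\<in>Z. card (D \<inter> L z)) = a * card Z + (b - a) * ((q - 1) * u)" .
  have "(\<Sum>z\<in>Z. card (D \<inter> perp (L z)) + t * q * card (D \<inter> L z)) = (\<Sum>z\<in>Z. k * (t * q + 1))"
  proof (rule sum.cong)
    fix z assume "z \<in> Z"
    then show "card (D \<inter> perp (L z)) + t * q * card (D \<inter> L z) = k * (t * q + 1)"
      using Suc.IH[OF L(1,2)[OF Z]] by (simp add: t_def mult.commute)
  qed simp
  then have main: "a * card Z + (b - a) * v + t * q * (a * card Z + (b - a) * ((q - 1) * u))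
      = card Z * (k * (t * q + 1))"
    by (simp add: sum.distrib sum1 sum2 flip: sum_distrib_left)
  have pos: "u > 0" "t > 0" using q_ge_2 by (auto simp: u_def t_def)
  have "u * t * q * q * 1 \<le> u * t * q * q * t" "u * 1 \<le> u * (t * q)"
    using pos q_ge_2 by (intro mult_le_mono2; simp)+
  then have "u * t * q * q \<le> u * t * q * t * q" "u \<le> u * t * q" by (simp_all add: ac_simps)
  then have "v + u + u * t * q * q = u * t * q + u * t * q * t * q"
    unfolding v_def by linarith
  then have v: "real v + u + u * t * q * q = u * t * q + u * t * q * t * q"
    by (metis of_nat_add of_nat_mult)
  have cZ: "real (card Z) = real u * (real t * q - 1) * (real t * q * q + 1)"
    using card_Z[THEN arg_cong[where f=real]] by (simp add: algebra_simps)
  have "real a * card Z + (real b - a) * v + t * q * (a * card Z + (real b - a) * ((real q - 1) * u))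
      = card Z * (k * (t * q + 1))"
    using main[THEN arg_cong[where f=real]] ab q_ge_2 by (simp add: of_nat_diff)
  moreover have "real v = real u * (real t * q - 1) * (real t * q + 1) - real t * q * ((real q - 1) * u)"
    using v by (simp add: algebra_simps)
  \<comment> \<open>The coefficient of \<open>b\<close> is
    \<open>v + t q (q - 1) u = u (t q - 1) (t q + 1)\<close>. This divides every term and is then
    cancelled, being positive since \<open>t q > 1\<close>.\<close>
  ultimately have "(real u * (real t * q - 1) * (real t * q + 1)) * (real b + t * q * q * a)
      = (real u * (real t * q - 1) * (real t * q + 1)) * (k * (real t * q * q + 1))"
    unfolding of_nat_add of_nat_mult of_nat_1 cZ by (simp add: algebra_simps)
  moreover have "real t * real q > 1"
    using pos q_ge_2 mult_mono[of 1 "real t" 2 "real q"] by simp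
  ultimately have "real b + real t * q * q * a = k * (real t * q * q + 1)"
    using pos by (simp add: add_nonneg_eq_0_iff)
  then have "real (b + t * q * q * a) = real (k * (t * q * q + 1))" by (simp add: algebra_simps)
  then have "b + t * q * q * a = k * (t * q * q + 1)" by (rule of_nat_eq_iff[THEN iffD1])
  then show ?case by (simp add: a_def b_def t_def ac_simps)
qed

lemma card_D: "card D = k * (q ^ (r + 1) + 1)"
proof -
  have "perp {0} = UNIV" by (simp add: perp_def)
  then show ?thesis
    using card_D_perp[OF totally_singular_zero, of r] D_nonzero by simp
qed

lemma card_D_line:
  assumes "w \<noteq> 0"
  shows "card (D \<inter> vec.span {w}) = (if w \<in> D then q - 1 else 0)"
proof (cases "w \<in> D")
  case True
  have "D \<inter> vec.span {w} = vec.span {w} - {0}"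
    using True D_scale D_nonzero by (auto simp: vec.span_singleton)
  moreover have "card (vec.span {w}) = q"
    using assms by (simp add: card_subspace_q)
  ultimately show ?thesis
    using True by (simp add: card_Diff_subset vec.span_zero)
next
  case False
  have "y \<notin> D" if y: "y \<in> vec.span {w}" for y
  proof
    assume "y \<in> D"
    obtain c where c: "y = c *s w" using y by (auto simp: vec.span_singleton)
    with \<open>y \<in> D\<close> D_nonzero have "c \<noteq> 0" by auto
    with D_scale[OF \<open>y \<in> D\<close>, of "inverse c"] c False show False by simp
  qed
  then have "D \<inter> vec.span {w} = {}" by auto
  with False show ?thesis by simp
qed

section \<open>Intersection numbers with hyperplanes\<close>

definition h :: real where "h = k * (real q ^ r + 1)"

abbreviation g :: "'a ^ 'n \<Rightarrow> real" where "g w \<equiv> real (card (D \<inter> perp {w}))"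

lemma rank_pos: "Q w = 0 \<Longrightarrow> w \<noteq> 0 \<Longrightarrow> r \<ge> 1"
  using dim_totally_singular_le[OF totally_singular_insert[OF totally_singular_zero, of w]]
  by (auto simp: perp_def vec.dim_insert vec.span_insert_0 insert_commute)

lemma g_singular:
  assumes "Q w = 0" "w \<noteq> 0"
  shows "g w = h - (if w \<in> D then (real q - 1) * real q ^ r else 0)"
proof -
  have U: "totally_singular Q (vec.span {w})"
    using totally_singular_insert[OF totally_singular_zero, of w] assms(1)
    by (simp add: perp_def insert_commute vec.span_insert_0)
  have d: "vec.dim (vec.span {w}) = 1" using assms by simp
  \<comment> \<open>\<open>card_D_perp\<close> is applied to a line, with \<open>i = r - 1\<close>;
    \<open>rank_pos\<close> guarantees that this does not truncate, so the exponent
    \<open>i + 1\<close> is \<open>r\<close>.\<close>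
  have r: "r - 1 + 1 = r" using rank_pos[OF assms] by simp
  have "card (D \<inter> perp {w}) + q ^ r * card (D \<inter> vec.span {w}) = k * (q ^ r + 1)"
    using card_D_perp[OF U, of "r - 1"] d r by (simp add: perp_span)
  then have "real (card (D \<inter> perp {w}) + q ^ r * card (D \<inter> vec.span {w})) = real (k * (q ^ r + 1))"
    by (rule arg_cong)
  then show ?thesis
    using card_D_line[OF assms(2)] q_ge_2 by (auto simp: h_def of_nat_diff algebra_simps split: if_splits)
qed

lemma g_zero: "g 0 = h + k * (real q - 1) * real q ^ r"
proof -
  have "perp {0} = UNIV" by (simp add: perp_def)
  then show ?thesis by (simp add: card_D h_def algebra_simps)
qed

lemma sum_g: "(\<Sum>w\<in>E. g w) = (\<Sum>y\<in>D. real (card (E \<inter> perp {y})))"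
proof -
  have "(\<Sum>w\<in>E. card {y \<in> D. polar Q w y = 0}) = (\<Sum>y\<in>D. card {w \<in> E. polar Q w y = 0})"
    unfolding card_eq_sum by (rule sum.swap_restrict) auto
  moreover have "D \<inter> perp {w} = {y \<in> D. polar Q w y = 0}" for w
    by (auto simp: perp_def polar_sym)
  moreover have "E \<inter> perp {y} = {w \<in> E. polar Q w y = 0}" for y
    by (auto simp: perp_def)
  ultimately show ?thesis by (simp flip: of_nat_sum)
qed

text \<open>One factor of the square is opened as a sum over \<open>D\<close>, and
  \<open>sum_g\<close> then applies to \<open>E \<inter> perp {y}\<close>. The set \<open>E\<close>
  stays free: it is the whole space for \<open>g_nonzero\<close> and \<open>perp {x}\<close> for the
  final bound.\<close>

lemma sum_g_sq: "(\<Sum>w\<in>E. (g w)\<^sup>2) = (\<Sum>y\<in>D. \<Sum>y'\<in>D. real (card (E \<inter> perp {y, y'})))"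
proof -
  have pair: "perp {y, y'} = perp {y} \<inter> perp {y'}" for y y' by (auto simp: perp_def)
  have "(g w)\<^sup>2 = (\<Sum>y\<in>D. g w * of_bool (polar Q w y = 0))" for w
  proof -
    have "D \<inter> perp {w} = {y \<in> D. polar Q w y = 0}"
      by (auto simp: perp_def polar_sym)
    then have "g w = (\<Sum>y\<in>D. of_bool (polar Q w y = 0))" by (simp add: Int_def)
    then show ?thesis by (simp add: power2_eq_square sum_distrib_left)
  qed
  then have "(\<Sum>w\<in>E. (g w)\<^sup>2) = (\<Sum>w\<in>E. \<Sum>y\<in>D. g w * of_bool (polar Q w y = 0))" by simp
  also have "\<dots> = (\<Sum>y\<in>D. \<Sum>w\<in>E. g w * of_bool (polar Q w y = 0))" by (rule sum.swap)
  also have "\<dots> = (\<Sum>y\<in>D. \<Sum>w\<in>E \<inter> perp {y}. g w)"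
    by (intro sum.cong sum.mono_neutral_cong_right) (auto simp: perp_def)
  also have "\<dots> = (\<Sum>y\<in>D. \<Sum>y'\<in>D. real (card (E \<inter> perp {y, y'})))"
    by (simp add: sum_g Int_assoc pair)
  finally show ?thesis .
qed

lemma sum_line_indicator:
  assumes "y \<in> D"
  shows "(\<Sum>y'\<in>D. of_bool (y' \<in> vec.span {y})) = real q - 1"
proof -
  have "(\<Sum>y'\<in>D. of_bool (y' \<in> vec.span {y})) = real (card (D \<inter> vec.span {y}))"
    by (simp add: Int_def)
  moreover have "y \<noteq> 0" using assms D_nonzero by auto
  ultimately show ?thesis using card_D_line[of y] assms q_ge_2 by (simp add: of_nat_diff)
qed

lemma card_perp_single:
  assumes "y \<noteq> 0" shows "real (card (perp {y})) = real q * real q ^ (2 * r)"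
proof -
  have "card (vec.span {y}) = q" using assms by (simp add: card_subspace_q)
  then have "card (perp {y}) * q = (q * q ^ (2 * r)) * q"
    using card_perp_span[of "{y}"] by auto
  then have "card (perp {y}) = q * q ^ (2 * r)" using q_ge_2 by simp
  then show ?thesis by simp
qed

text \<open>A dependent pair imposes one linear condition instead of two. Writing the excess with an
  indicator lets \<open>sum_line_indicator\<close> evaluate the sums over \<open>D\<close>.\<close>

lemma card_perp_pair:
  assumes "y \<noteq> 0"
  shows "real (card (perp {y, y'})) = real q ^ (2 * r) + (real q - 1) * real q ^ (2 * r) * of_bool (y' \<in> vec.span {y})"
proof (cases "y' \<in> vec.span {y}")
  case True
  then have "vec.span {y, y'} = vec.span {y}"
    using vec.span_redundant[of y' "{y}"] by (simp add: insert_commute)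
  then have "perp {y, y'} = perp {y}" by (metis perp_span)
  with card_perp_single[OF assms] True show ?thesis by (simp add: algebra_simps)
next
  case False
  then have "card (vec.span {y, y'}) = q\<^sup>2"
    using assms vec.dim_insert[of y' "{y}"] by (simp add: card_subspace_q insert_commute numeral_2_eq_2)
  then have "card (perp {y, y'}) * q\<^sup>2 = q ^ (2 * r) * q\<^sup>2"
    using card_perp_span[of "{y, y'}"] by (simp only: power_add)
  then have "card (perp {y, y'}) = q ^ (2 * r)" using q_ge_2 by simp
  with False show ?thesis by simp
qed

text \<open>The second moment of \<open>h - g\<close> over all nonzero vectors is exhausted by its values on \<open>D\<close>.
  This replaces the count of generators in the parabolic sections by nonsingular hyperplanes.\<close>

lemma g_nonzero:
  assumes "w \<noteq> 0"
  shows "g w = h - (if w \<in> D then (real q - 1) * real q ^ r else 0)"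
proof -
  let ?c = "(real q - 1) * real q ^ r" and ?d = "real (card D)" and ?p = "real q ^ r"
  have d: "?d = k * (real q * ?p + 1)" by (simp add: card_D algebra_simps)
  have p2: "real q ^ (2 * r) = ?p\<^sup>2" by (simp add: power_even_eq)
  have D0: "y \<noteq> 0" if "y \<in> D" for y using that D_nonzero by auto
  have s1: "(\<Sum>w\<in>UNIV. g w) = ?d * (real q * ?p\<^sup>2)"
    using D0 by (simp add: sum_g card_perp_single p2)
  have "(\<Sum>w\<in>UNIV. (g w)\<^sup>2) = (\<Sum>y\<in>D. \<Sum>y'\<in>D. ?p\<^sup>2 + (real q - 1) * ?p\<^sup>2 * of_bool (y' \<in> vec.span {y}))"
    using D0 by (simp add: sum_g_sq card_perp_pair p2)
  also have "\<dots> = (\<Sum>y\<in>D. ?d * ?p\<^sup>2 + (real q - 1) * ?p\<^sup>2 * (real q - 1))"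
    by (intro sum.cong) (simp_all only: sum.distrib sum_line_indicator sum_constant flip: sum_distrib_left)
  finally have s2: "(\<Sum>w\<in>UNIV. (g w)\<^sup>2) = ?d * (?d * ?p\<^sup>2 + (real q - 1)\<^sup>2 * ?p\<^sup>2)"
    by (simp add: power2_eq_square algebra_simps)
  have s0: "real CARD('a ^ 'n) = (real q)\<^sup>2 * ?p\<^sup>2"
    unfolding card_space by (simp add: p2 power2_eq_square)
  have "(\<Sum>w\<in>UNIV. (h - g w)\<^sup>2) = (\<Sum>w\<in>UNIV. h\<^sup>2 - 2 * h * g w + (g w)\<^sup>2)"
    by (simp add: power2_diff algebra_simps)
  also have "\<dots> = real CARD('a ^ 'n) * h\<^sup>2 - 2 * h * (\<Sum>w\<in>UNIV. g w) + (\<Sum>w\<in>UNIV. (g w)\<^sup>2)"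
    by (simp only: sum.distrib sum_subtractf sum_constant flip: sum_distrib_left)
  also have "\<dots> = (k * ?c)\<^sup>2 + ?d * ?c\<^sup>2"
    unfolding s0 s1 s2 d h_def by algebra
  finally have "(\<Sum>w\<in>UNIV. (h - g w)\<^sup>2) = (k * ?c)\<^sup>2 + ?d * ?c\<^sup>2" .
  moreover have "(\<Sum>w\<in>UNIV. (h - g w)\<^sup>2)
      = (\<Sum>w\<in>UNIV - insert 0 D. (h - g w)\<^sup>2) + (\<Sum>w\<in>insert 0 D. (h - g w)\<^sup>2)"
    by (rule sum.subset_diff) auto
  \<comment> \<open>The vector \<open>0\<close> contributes \<open>(k * ?c)^2\<close> and each
    vector of \<open>D\<close> contributes \<open>?c^2\<close>. This is already the whole sum, so
    the squares at all other vectors vanish.\<close>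
  moreover have "(\<Sum>w\<in>insert 0 D. (h - g w)\<^sup>2) = (k * ?c)\<^sup>2 + ?d * ?c\<^sup>2"
    using D_nonzero D0 by (simp add: g_zero g_singular D_singular power_mult_distrib)
  ultimately have "(\<Sum>w\<in>UNIV - insert 0 D. (h - g w)\<^sup>2) = 0" by simp
  then have "\<forall>w\<in>UNIV - insert 0 D. (h - g w)\<^sup>2 = 0"
    by (subst (asm) sum_nonneg_eq_0_iff) auto
  then show ?thesis
    using assms g_singular[of w] D_singular[of w] by (cases "w \<in> D") auto
qed

text \<open>Only the dependencies forced by equal points are counted; collinear triples of distinct points
  of the \<open>m\<close>-ovoid are discarded, which is where the final bound becomes an inequality.\<close>

lemma card_perp_triple_ge:
  assumes "x \<noteq> 0" "y \<noteq> 0" "y' \<noteq> 0"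
  shows "real q * card (perp {x, y, y'}) \<ge> real q ^ (2 * r) *
    (if y \<in> vec.span {x} then real q + (real q * (real q - 1)) * of_bool (y' \<in> vec.span {x})
     else 1 + (real q - 1) * of_bool (y' \<in> vec.span {x}) + (real q - 1) * of_bool (y' \<in> vec.span {y}))"
proof -
  \<comment> \<open>Here \<open>i\<close> bounds the rank and \<open>j = 3 - i\<close>. The extra
    factor \<open>q\<close> keeps the exponent \<open>2 * r + j\<close> natural where the bare bound
    would have exponent \<open>2 * r + 2 - i\<close>.\<close>
  have ge: "real q * card (perp {x, y, y'}) \<ge> real q ^ (2 * r) * real q ^ j"
    if "vec.span {x, y, y'} = vec.span B" "card B \<le> i" "i + j = 3" for B i j
  proof -
    have "card (vec.span {x, y, y'}) \<le> q ^ i"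
      unfolding that(1) using card_span_le[of B] that(2) q_ge_2
      by (auto simp: CARD_field intro: order_trans power_increasing)
    then have "q ^ (2 * r + 2) \<le> card (perp {x, y, y'}) * q ^ i"
      using card_perp_span[of "{x, y, y'}"] by (metis mult_le_mono2)
    then have "q * q ^ (2 * r + 2) \<le> q * (card (perp {x, y, y'}) * q ^ i)"
      by (rule mult_le_mono2)
    also have "q * q ^ (2 * r + 2) = q ^ Suc (2 * r + 2)" by simp
    also have "Suc (2 * r + 2) = 2 * r + j + i" using that(3) by simp
    also have "q ^ (2 * r + j + i) = q ^ (2 * r) * q ^ j * q ^ i" by (simp only: power_add)
    finally have "q ^ (2 * r) * q ^ j \<le> q * card (perp {x, y, y'})"
      using q_ge_2 by (simp flip: mult.assoc)
    then have "real (q ^ (2 * r) * q ^ j) \<le> real (q * card (perp {x, y, y'}))"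
      by (rule of_nat_mono)
    then show ?thesis by simp
  qed
  consider "y \<in> vec.span {x}" "y' \<in> vec.span {x}" | "y \<in> vec.span {x}" "y' \<notin> vec.span {x}"
    | "y \<notin> vec.span {x}" "y' \<in> vec.span {x}" | "y \<notin> vec.span {x}" "y' \<notin> vec.span {x}" "y' \<in> vec.span {y}"
    | "y \<notin> vec.span {x}" "y' \<notin> vec.span {x}" "y' \<notin> vec.span {y}" by blast
  then show ?thesis
  proof cases
    case 1
    then have "vec.span {x, y, y'} = vec.span {x}"
      using vec.span_redundant[of y "{x, y'}"] vec.span_redundant[of y' "{x}"] vec.span_mono[of "{x}" "{x, y'}"]
      by (auto simp: insert_commute)
    from ge[OF this, of 1 2] 1 show ?thesis by (simp add: power2_eq_square algebra_simps)
  next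
    case 2
    then have "vec.span {x, y, y'} = vec.span {x, y'}"
      using vec.span_redundant[of y "{x, y'}"] vec.span_mono[of "{x}" "{x, y'}"]
      by (auto simp: insert_commute)
    from ge[OF this, of 2 1] 2 show ?thesis by (simp add: card_insert_if)
  next
    case 3
    then have "vec.span {x, y, y'} = vec.span {x, y}"
      using vec.span_redundant[of y' "{x, y}"] vec.span_mono[of "{x}" "{x, y}"]
      by (auto simp: insert_commute)
    note ge[OF this, of 2 1]
    \<comment> \<open>The two indicators of the \<open>else\<close> branch are never both 1, so a
      single correction suffices.\<close>
    moreover have "y' \<notin> vec.span {y}"
    proof
      assume "y' \<in> vec.span {y}"
      then obtain c where c: "y' = c *s y" by (auto simp: vec.span_singleton)
      with assms(3) have "c \<noteq> 0" by auto
      with c vec.span_scale[OF 3(2), of "inverse c"] have "y \<in> vec.span {x}" by simp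
      with 3 show False by simp
    qed
    ultimately show ?thesis using 3 by (simp add: card_insert_if)
  next
    case 4
    then have "vec.span {x, y, y'} = vec.span {x, y}"
      using vec.span_redundant[of y' "{x, y}"] vec.span_mono[of "{y}" "{x, y}"]
      by (auto simp: insert_commute)
    from ge[OF this, of 2 1] 4 show ?thesis by (simp add: card_insert_if)
  next
    case 5
    from ge[OF refl, of 3 0] 5 show ?thesis by (simp add: card_insert_if)
  qed
qed

lemma vector_ovoid_bound:
  assumes "x \<in> D"
  shows "q ^ (r + 1) + q \<le> (k + 1) * (k + 2)"
proof -
  let ?c = "(real q - 1) * real q ^ r" and ?d = "real (card D)" and ?p = "real q ^ r"
  have d: "?d = k * (real q * ?p + 1)" by (simp add: card_D algebra_simps)
  have p2: "real q ^ (2 * r) = ?p\<^sup>2" by (simp add: power_even_eq)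
  have D0: "y \<noteq> 0" if "y \<in> D" for y using that D_nonzero by auto
  have gx: "g x = h - ?c" using assms by (simp add: g_nonzero D0)
  \<comment> \<open>The coefficients are the deviations of \<open>(g w)^2\<close> from
    \<open>h^2\<close>: \<open>(h + k * ?c)^2 - h^2\<close> at \<open>0\<close> and
    \<open>(h - ?c)^2 - h^2\<close> on \<open>D\<close>.\<close>
  have g: "(g w)\<^sup>2 = h\<^sup>2 + (2 * h * k * ?c + (k * ?c)\<^sup>2) * of_bool (w = 0) + (?c\<^sup>2 - 2 * h * ?c) * of_bool (w \<in> D)"
    for w
  proof (cases "w = 0")
    case True
    then show ?thesis using D_nonzero by (simp add: g_zero power2_eq_square algebra_simps)
  next
    case False
    then show ?thesis by (simp add: g_nonzero power2_eq_square algebra_simps)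
  qed
  have "(\<Sum>w\<in>perp {x}. of_bool (w = 0)) = (1::real)"
    using vec.subspace_0[OF subspace_perp] by (simp add: of_bool_def)
  moreover have "(\<Sum>w\<in>perp {x}. of_bool (w \<in> D)) = g x"
    by (simp add: Int_def conj_commute)
  ultimately have "(\<Sum>w\<in>perp {x}. (g w)\<^sup>2)
    = card (perp {x}) * h\<^sup>2 + (2 * h * k * ?c + (k * ?c)\<^sup>2) * 1 + (?c\<^sup>2 - 2 * h * ?c) * (h - ?c)"
    unfolding g gx[symmetric] by (simp only: sum.distrib sum_constant flip: sum_distrib_left)
  then have upper: "(\<Sum>w\<in>perp {x}. (g w)\<^sup>2)
    = real q * ?p\<^sup>2 * h\<^sup>2 + (2 * h * k * ?c + (k * ?c)\<^sup>2) + (?c\<^sup>2 - 2 * h * ?c) * (h - ?c)"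
    by (simp add: card_perp_single[OF D0[OF assms]] p2)
  \<comment> \<open>Up to the factor \<open>?p^2\<close>, \<open>?A\<close> and \<open>?B\<close>
    are the sums over \<open>y'\<close> of the lower bound in \<open>card_perp_triple_ge\<close>,
    for \<open>y\<close> on the line of \<open>x\<close> and off it.\<close>
  let ?A = "?d * real q + real q * (real q - 1) * (real q - 1)"
  let ?B = "?d + 2 * (real q - 1)\<^sup>2"
  have "?p\<^sup>2 * (?d * ?B + (?A - ?B) * (real q - 1))
    = (\<Sum>y\<in>D. ?p\<^sup>2 * (?B + (?A - ?B) * of_bool (y \<in> vec.span {x})))"
    by (simp only: sum.distrib sum_line_indicator[OF assms] sum_constant flip: sum_distrib_left)
      (simp only: distrib_left)
  also have "\<dots> = (\<Sum>y\<in>D. \<Sum>y'\<in>D. ?p\<^sup>2 *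
    (if y \<in> vec.span {x} then real q + (real q * (real q - 1)) * of_bool (y' \<in> vec.span {x})
     else 1 + (real q - 1) * of_bool (y' \<in> vec.span {x}) + (real q - 1) * of_bool (y' \<in> vec.span {y})))"
  proof (rule sum.cong[OF refl])
    fix y assume y: "y \<in> D"
    show "?p\<^sup>2 * (?B + (?A - ?B) * of_bool (y \<in> vec.span {x})) = (\<Sum>y'\<in>D. ?p\<^sup>2 *
    (if y \<in> vec.span {x} then real q + (real q * (real q - 1)) * of_bool (y' \<in> vec.span {x})
     else 1 + (real q - 1) * of_bool (y' \<in> vec.span {x}) + (real q - 1) * of_bool (y' \<in> vec.span {y})))"
      by (cases "y \<in> vec.span {x}")
        (simp_all only: if_True if_False simp_thms sum.distrib sum_line_indicator[OF assms] sum_line_indicator[OF y] sum_constant of_bool_eq flip: sum_distrib_left,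
          simp_all add: power2_eq_square algebra_simps)
  qed
  also have "\<dots> \<le> (\<Sum>y\<in>D. \<Sum>y'\<in>D. real q * card (perp {x, y, y'}))"
    unfolding p2[symmetric] by (intro sum_mono card_perp_triple_ge D0 assms)
  also have "\<dots> = real q * (\<Sum>w\<in>perp {x}. (g w)\<^sup>2)"
    unfolding sum_g_sq sum_distrib_left
    by (intro sum.cong refl arg_cong2[where f="(*)"] arg_cong[where f=real] arg_cong[where f=card])
      (auto simp: perp_def)
  finally have "?p\<^sup>2 * (?d * ?B + (?A - ?B) * (real q - 1)) \<le> real q *
     (real q * ?p\<^sup>2 * h\<^sup>2 + (2 * h * k * ?c + (k * ?c)\<^sup>2) + (?c\<^sup>2 - 2 * h * ?c) * (h - ?c))"
    unfolding upper .
  \<comment> \<open>After inserting \<open>card D\<close> and \<open>h\<close>, the gap between the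
    exact moment and its lower bound is a positive multiple of the gap in the claim.\<close>
  moreover have "real q * (real q * ?p\<^sup>2 * h\<^sup>2 + (2 * h * k * ?c + (k * ?c)\<^sup>2) + (?c\<^sup>2 - 2 * h * ?c) * (h - ?c))
     - ?p\<^sup>2 * (?d * ?B + (?A - ?B) * (real q - 1))
     = ?p\<^sup>2 * (real q - 1) ^ 3 * ((real k + 1) * (real k + 2) - (real q * ?p + real q))"
    unfolding d h_def by algebra
  ultimately have "0 \<le> ?p\<^sup>2 * (real q - 1) ^ 3 * ((real k + 1) * (real k + 2) - (real q * ?p + real q))"
    by linarith
  moreover have "?p\<^sup>2 * (real q - 1) ^ 3 > 0" using q_ge_2 by simp
  ultimately have "real q * ?p + real q \<le> (real k + 1) * (real k + 2)"
    by (simp add: zero_le_mult_iff)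
  then have "real (q ^ (r + 1) + q) \<le> real ((k + 1) * (k + 2))" by (simp add: algebra_simps)
  then show ?thesis by (rule of_nat_le_iff[THEN iffD1])
qed

end

text \<open>Distinct points share only \<open>0\<close> and each has \<open>q - 1\<close> nonzero
  vectors, so the \<open>m\<close> points in a generator give \<open>(q - 1) * m\<close> vectors. A
  point having a nonzero vector in a subspace is spanned by it and lies inside.\<close>

lemma m_ovoid_vectors:
  fixes Q :: "'a::{field,finite} ^ 'n \<Rightarrow> 'a"
  assumes q: "CARD('a) = q" and Q: "elliptic_form r Q" and X: "m_ovoid Q m X"
  shows "vector_ovoid Q q r (\<Union>X - {0}) ((q - 1) * m)"
proof -
  interpret quadratic_space Q
    using Q by unfold_locales (simp add: elliptic_form_def)
  interpret elliptic_space Q q r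
    using q Q by unfold_locales
  have P: "vec.subspace P" "vec.dim P = 1" "\<And>y. y \<in> P \<Longrightarrow> Q y = 0" if "P \<in> X" for P
    using that X by (auto simp: m_ovoid_def quadric_def totally_singular_def)
  have span: "vec.span {y} = P" if "P \<in> X" "y \<in> P" "y \<noteq> 0" for y P
    using that P[OF that(1)] by (intro vec.subspace_dim_equal) (auto simp: vec.span_minimal)
  have disj: "(P - {0}) \<inter> (P' - {0}) = {}" if "P \<in> X" "P' \<in> X" "P \<noteq> P'" for P P'
    using span[of P] span[of P'] that by blast
  show ?thesis
  proof unfold_locales
    fix U assume U: "generator Q U"
    then have sU: "vec.subspace U" by (simp add: generator_def totally_singular_def)
    let ?Y = "{P \<in> X. P \<subseteq> U}"
    have "(\<Union>X - {0}) \<inter> U = (\<Union>P\<in>?Y. P - {0})"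
    proof (intro equalityI subsetI)
      fix y assume y: "y \<in> (\<Union>X - {0}) \<inter> U"
      then obtain P where "P \<in> X" "y \<in> P" by auto
      moreover from this y have "P \<subseteq> U"
        using span[of P y] vec.span_minimal[of "{y}" U] sU by auto
      ultimately show "y \<in> (\<Union>P\<in>?Y. P - {0})" using y by auto
    qed auto
    then have "card ((\<Union>X - {0}) \<inter> U) = card (\<Union>P\<in>?Y. P - {0})" by (rule arg_cong)
    also have "\<dots> = (\<Sum>P\<in>?Y. card (P - {0}))"
      by (rule card_UN_disjoint) (simp_all add: disj)
    also have "\<dots> = (\<Sum>P\<in>?Y. q - 1)"
    proof (rule sum.cong)
      fix P assume "P \<in> ?Y"
      then show "card (P - {0}) = q - 1"
        using P[of P] by (simp add: card_Diff_subset card_subspace_q vec.subspace_0)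
    qed simp
    also have "\<dots> = (q - 1) * m"
      using X U by (simp add: m_ovoid_def)
    finally show "card ((\<Union>X - {0}) \<inter> U) = (q - 1) * m" .
  qed (use P in \<open>auto intro: vec.subspace_scale\<close>)
qed

theorem theorem4p1:
  fixes Q :: "'a::{field,finite} ^ 'n \<Rightarrow> 'a" and q r m :: nat
  assumes "CARD('a) = q"
    and "r \<ge> 1"
    and "elliptic_form r Q"
    and "m > 0"
    and "\<exists>X. m_ovoid Q m X"
  shows "real m \<ge> (sqrt (4 * real q ^ (r + 1) + 4 * real q + 1) - 3) / (2 * (real q - 1))"
proof -
  obtain X where X: "m_ovoid Q m X" using assms(5) by blast
  define k where "k = (q - 1) * m"
  interpret vector_ovoid Q q r "\<Union>X - {0}" k
    unfolding k_def by (rule m_ovoid_vectors[OF assms(1,3) X])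
  have k: "real k = (real q - 1) * real m" using q_ge_2 by (simp add: k_def of_nat_diff)
  \<comment> \<open>A generator meets the set in \<open>k > 0\<close> vectors, which supplies the
    vector \<open>x\<close> for the bound.\<close>
  obtain W where "totally_singular Q W" "vec.dim W = r" by (rule ex_totally_singular)
  then have "card ((\<Union>X - {0}) \<inter> W) > 0"
    using card_D_generator[of W] assms(4) q_ge_2 by (simp add: generator_iff k_def)
  then obtain x where "x \<in> \<Union>X - {0}" by (auto simp: card_gt_0_iff)
  then have "q ^ (r + 1) + q \<le> (k + 1) * (k + 2)" by (rule vector_ovoid_bound)
  then have "real (q ^ (r + 1) + q) \<le> real ((k + 1) * (k + 2))" by (rule of_nat_mono)
  \<comment> \<open>Completing the square:
    \<open>4 (k + 1) (k + 2) + 1 = (2 k + 3)^2\<close>.\<close>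
  then have "4 * real q ^ (r + 1) + 4 * real q + 1 \<le> (2 * real k + 3)\<^sup>2"
    by (simp add: power2_eq_square algebra_simps)
  then have "sqrt (4 * real q ^ (r + 1) + 4 * real q + 1) \<le> 2 * real k + 3"
    by (intro real_le_lsqrt) auto
  then show ?thesis
    using q_ge_2 by (simp add: divide_le_eq k algebra_simps)
qed

end
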